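(* Let $G$ be a finite group and $\mathcal C\subset G$ a conjugacy class (or, more generally, a subset stable under conjugation) not containing the identity, and let $L=\mathbb C\mathcal C$ be the associated braided-Lie algebra, with basis $\{x^a\}_{a\in\mathcal C}$, bracket $[x^a,x^b]=x^{b^{-1}ab}$ and coproduct $\Delta x^a=x^a\otimes x^a$. The braided-Killing form of $L$ is a symmetric, positive-integer valued and $\mathrm{Ad}$-invariant bilinear form on the conjugacy class given by $$\eta(x^a,x^b)=n(ab)\equiv\#\{c\in\mathcal C\mid c\,ab=ab\,c\}=\eta(x^b,x^{b^{-1}ab}),\qquad\forall a,b\in\mathcal C .$$ A conjugacy class is said to be semisimple if this associated Killing form is nondegenerate.
   Context: The braided-Killing form of $L$ is the trace $\eta(x^a,x^b)=\sum_{c\in\mathcal C}\langle\delta_c,[[x^c,x^a],x^b]\rangle$, where $\{\delta_c\}$ is the basis dual to $\{x^c\}$, extended bilinearly. $\mathrm{Ad}$-invariance means $\eta(x^{gag^{-1}},x^{gbg^{-1}})=\eta(x^a,x^b)$ for all $g\in G$.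
   Formalization: "Positive-integer valued" is read as non-negative-integer valued, since n(ab) can be 0: for the transpositions in S_3 with a=(12), b=(23), the product ab is a 3-cycle commuting with no transposition. *)

theory Defs
  imports Complex_Main "HOL-Algebra.Group" "HOL-Library.Poly_Mapping"
begin

text \<open>
  The complex vector space with basis a set \<open>S\<close> is the set of finitely supported functions
  with support in \<open>S\<close>; its basis vectors are \<open>x\<^sup>a\<close> = \<open>bvec a\<close>, the dual basis is
  \<open>\<langle>\<delta>\<^sub>c, v\<rangle> = lookup v c\<close>, and its tensor square is the space with basis \<open>S \<times> S\<close>.
\<close>

definition free_space :: "'a set \<Rightarrow> ('a \<Rightarrow>\<^sub>0 complex) set" where
  "free_space S = {v. Poly_Mapping.keys v \<subseteq> S}"

definition bvec :: "'a \<Rightarrow> ('a \<Rightarrow>\<^sub>0 complex)" where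
  "bvec a = Poly_Mapping.single a 1"

definition cscale :: "complex \<Rightarrow> ('a \<Rightarrow>\<^sub>0 complex) \<Rightarrow> ('a \<Rightarrow>\<^sub>0 complex)" where
  "cscale k v = Poly_Mapping.map (\<lambda>z. k * z) v"

definition tensor :: "('a \<Rightarrow>\<^sub>0 complex) \<Rightarrow> ('b \<Rightarrow>\<^sub>0 complex) \<Rightarrow> ('a \<times> 'b \<Rightarrow>\<^sub>0 complex)" where
  "tensor v w = (\<Sum>a\<in>Poly_Mapping.keys v. \<Sum>b\<in>Poly_Mapping.keys w.
     cscale (Poly_Mapping.lookup v a * Poly_Mapping.lookup w b) (bvec (a, b)))"

definition bilinear_form_on ::
  "('a \<Rightarrow>\<^sub>0 complex) set \<Rightarrow> (('a \<Rightarrow>\<^sub>0 complex) \<Rightarrow> ('a \<Rightarrow>\<^sub>0 complex) \<Rightarrow> complex) \<Rightarrow> bool" where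
  "bilinear_form_on V B \<longleftrightarrow>
     (\<forall>u\<in>V. \<forall>v\<in>V. \<forall>w\<in>V. B (u + v) w = B u w + B v w \<and> B w (u + v) = B w u + B w v) \<and>
     (\<forall>k. \<forall>v\<in>V. \<forall>w\<in>V. B (cscale k v) w = k * B v w \<and> B w (cscale k v) = k * B w v)"

definition symmetric_form_on ::
  "('a \<Rightarrow>\<^sub>0 complex) set \<Rightarrow> (('a \<Rightarrow>\<^sub>0 complex) \<Rightarrow> ('a \<Rightarrow>\<^sub>0 complex) \<Rightarrow> complex) \<Rightarrow> bool" where
  "symmetric_form_on V B \<longleftrightarrow> (\<forall>v\<in>V. \<forall>w\<in>V. B v w = B w v)"

definition nondegenerate_form_on ::
  "('a \<Rightarrow>\<^sub>0 complex) set \<Rightarrow> (('a \<Rightarrow>\<^sub>0 complex) \<Rightarrow> ('a \<Rightarrow>\<^sub>0 complex) \<Rightarrow> complex) \<Rightarrow> bool" where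
  "nondegenerate_form_on V B \<longleftrightarrow>
     (\<forall>v\<in>V. (\<forall>w\<in>V. B v w = 0) \<longrightarrow> v = 0) \<and>
     (\<forall>w\<in>V. (\<forall>v\<in>V. B v w = 0) \<longrightarrow> w = 0)"

text \<open>The data of a braided-Lie algebra with chosen basis; the axioms are not part of the record.\<close>

record 'a braided_lie =
  bl_basis :: "'a set"
  bl_bracket :: "('a \<Rightarrow>\<^sub>0 complex) \<Rightarrow> ('a \<Rightarrow>\<^sub>0 complex) \<Rightarrow> ('a \<Rightarrow>\<^sub>0 complex)"
  bl_coprod :: "('a \<Rightarrow>\<^sub>0 complex) \<Rightarrow> ('a \<times> 'a \<Rightarrow>\<^sub>0 complex)"

definition bl_space :: "'a braided_lie \<Rightarrow> ('a \<Rightarrow>\<^sub>0 complex) set" where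
  "bl_space L = free_space (bl_basis L)"

text \<open>
  The (bi)linear extensions of \<open>[x\<^sup>a, x\<^sup>b] = x\<^bsup>inv b a b\<^esup>\<close> and of
  \<open>\<Delta> x\<^sup>a = x\<^sup>a \<otimes> x\<^sup>a\<close>.
\<close>

definition class_braided_lie :: "('a, 'm) monoid_scheme \<Rightarrow> 'a set \<Rightarrow> 'a braided_lie" where
  "class_braided_lie G C = \<lparr>
     bl_basis = C,
     bl_bracket = (\<lambda>v w. \<Sum>a\<in>Poly_Mapping.keys v. \<Sum>b\<in>Poly_Mapping.keys w.
        cscale (Poly_Mapping.lookup v a * Poly_Mapping.lookup w b)
          (bvec (inv\<^bsub>G\<^esub> b \<otimes>\<^bsub>G\<^esub> a \<otimes>\<^bsub>G\<^esub> b))),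
     bl_coprod = (\<lambda>v. \<Sum>a\<in>Poly_Mapping.keys v.
        cscale (Poly_Mapping.lookup v a) (tensor (bvec a) (bvec a))) \<rparr>"

text \<open>
  The trace of \<open>z \<mapsto> [[z, x\<^sup>a], x\<^sup>b]\<close>, which is then extended bilinearly in the two
  basis vectors.
\<close>

definition braided_killing_basis :: "'a braided_lie \<Rightarrow> 'a \<Rightarrow> 'a \<Rightarrow> complex" where
  "braided_killing_basis L a b = (\<Sum>c\<in>bl_basis L.
     Poly_Mapping.lookup (bl_bracket L (bl_bracket L (bvec c) (bvec a)) (bvec b)) c)"

definition braided_killing ::
  "'a braided_lie \<Rightarrow> ('a \<Rightarrow>\<^sub>0 complex) \<Rightarrow> ('a \<Rightarrow>\<^sub>0 complex) \<Rightarrow> complex" where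
  "braided_killing L v w = (\<Sum>a\<in>Poly_Mapping.keys v. \<Sum>b\<in>Poly_Mapping.keys w.
     Poly_Mapping.lookup v a * Poly_Mapping.lookup w b * braided_killing_basis L a b)"

definition conjugation_stable :: "('a, 'm) monoid_scheme \<Rightarrow> 'a set \<Rightarrow> bool" where
  "conjugation_stable G C \<longleftrightarrow>
     C \<subseteq> carrier G \<and> (\<forall>g\<in>carrier G. \<forall>a\<in>C. g \<otimes>\<^bsub>G\<^esub> a \<otimes>\<^bsub>G\<^esub> inv\<^bsub>G\<^esub> g \<in> C)"

text \<open>
  This can be \<open>0\<close> at \<open>h = a b\<close> with \<open>a, b \<in> C\<close>, e.g. for distinct transpositions \<open>a, b\<close> in
  \<open>S\<^sub>3\<close>; so integrality of the Killing form is in the sense of non-negative integers.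
\<close>

definition commuting_count :: "('a, 'm) monoid_scheme \<Rightarrow> 'a set \<Rightarrow> 'a \<Rightarrow> nat" where
  "commuting_count G C h = card {c \<in> C. c \<otimes>\<^bsub>G\<^esub> h = h \<otimes>\<^bsub>G\<^esub> c}"

definition semisimple_class :: "('a, 'm) monoid_scheme \<Rightarrow> 'a set \<Rightarrow> bool" where
  "semisimple_class G C \<longleftrightarrow>
     nondegenerate_form_on (bl_space (class_braided_lie G C))
       (braided_killing (class_braided_lie G C))"

end

theory Submission
  imports Defs
begin

text \<open>
  Iterating the bracket gives \<open>[[x\<^sup>c, x\<^sup>a], x\<^sup>b] = x\<^bsup>inv (ab) c (ab)\<^esup>\<close>, so the trace counts
  the \<open>c\<close> commuting with \<open>ab\<close>. Since \<open>C\<close> is stable under conjugation, this number depends only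
  on the conjugacy class of \<open>ab\<close>; invariance follows, and symmetry because \<open>ba = b (ab) inv b\<close>.
\<close>

lemma lookup_bvec: "Poly_Mapping.lookup (bvec a) c = (if a = c then 1 else 0)"
  by (simp add: bvec_def lookup_single when_def)

lemma keys_bvec [simp]: "Poly_Mapping.keys (bvec a) = {a}"
  by (simp add: bvec_def)

text \<open>\<open>Poly_Mapping.map\<close> applies its function only at nonzero values; as
  \<open>k * 0 = 0\<close>, the formula also holds off the support.\<close>

lemma lookup_cscale: "Poly_Mapping.lookup (cscale k v) a = k * Poly_Mapping.lookup v a"
  by (simp add: cscale_def Poly_Mapping.map.rep_eq when_def)

lemma cscale_one [simp]: "cscale 1 v = v"
  by (rule poly_mapping_eqI) (simp add: lookup_cscale)

lemma cscale_in_free_space: "v \<in> free_space S \<Longrightarrow> cscale k v \<in> free_space S"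
  by (auto simp: free_space_def in_keys_iff lookup_cscale)

lemma add_in_free_space:
  assumes "u \<in> free_space S" "v \<in> free_space S"
  shows "u + v \<in> free_space S"
  using assms keys_add[of u v] by (auto simp: free_space_def)

text \<open>The support of a sum or of a scalar multiple may shrink, which makes the defining sum
  awkward for linearity. Summing over the fixed set \<open>S\<close> only adds zero terms, and
  bilinearity and symmetry can then be checked term by term.\<close>

lemma braided_killing_eq_sum:
  assumes "finite S" "v \<in> free_space S" "w \<in> free_space S"
  shows "braided_killing L v w = (\<Sum>a\<in>S. \<Sum>b\<in>S.
     Poly_Mapping.lookup v a * Poly_Mapping.lookup w b * braided_killing_basis L a b)"
proof -
  have vS: "Poly_Mapping.keys v \<subseteq> S" and wS: "Poly_Mapping.keys w \<subseteq> S"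
    using assms by (auto simp: free_space_def)
  have "braided_killing L v w = (\<Sum>a\<in>Poly_Mapping.keys v. \<Sum>b\<in>S.
     Poly_Mapping.lookup v a * Poly_Mapping.lookup w b * braided_killing_basis L a b)"
    unfolding braided_killing_def
    by (intro sum.cong refl sum.mono_neutral_left) (use assms wS in \<open>auto simp: in_keys_iff\<close>)
  also have "\<dots> = (\<Sum>a\<in>S. \<Sum>b\<in>S.
     Poly_Mapping.lookup v a * Poly_Mapping.lookup w b * braided_killing_basis L a b)"
    by (intro sum.mono_neutral_left) (use assms vS in \<open>auto simp: in_keys_iff\<close>)
  finally show ?thesis .
qed

lemma braided_killing_bvec: "braided_killing L (bvec a) (bvec b) = braided_killing_basis L a b"
  by (simp add: braided_killing_def lookup_bvec)

lemma bilinear_braided_killing: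
  assumes "finite S"
  shows "bilinear_form_on (free_space S) (braided_killing L)"
  unfolding bilinear_form_on_def
  by (simp add: braided_killing_eq_sum[OF assms] add_in_free_space cscale_in_free_space
      lookup_add lookup_cscale sum.distrib sum_distrib_left algebra_simps)

lemma symmetric_braided_killing:
  assumes "finite S"
    and "\<And>a b. a \<in> S \<Longrightarrow> b \<in> S \<Longrightarrow> braided_killing_basis L a b = braided_killing_basis L b a"
  shows "symmetric_form_on (free_space S) (braided_killing L)"
  unfolding symmetric_form_on_def
proof (intro ballI)
  fix v w assume "v \<in> free_space S" "w \<in> free_space S"
  then show "braided_killing L v w = braided_killing L w v"
    \<comment> \<open>Exchanging the two summations on one side aligns the index pairs, so that the
      terms agree by symmetry of the matrix on basis vectors.\<close>
    by (simp add: braided_killing_eq_sum[OF assms(1)], subst sum.swap)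
      (intro sum.cong refl, simp add: assms(2) mult.commute)
qed

lemma bracket_class_braided_lie:
  "bl_bracket (class_braided_lie G C) (bvec a) (bvec b) =
     bvec (inv\<^bsub>G\<^esub> b \<otimes>\<^bsub>G\<^esub> a \<otimes>\<^bsub>G\<^esub> b)"
  by (simp add: class_braided_lie_def lookup_bvec)

context group
begin

text \<open>Since \<open>inv (a \<otimes> b) = inv b \<otimes> inv a\<close>, the two conjugations
  combine into one by \<open>a \<otimes> b\<close>; multiplying by \<open>a \<otimes> b\<close> on
  the left turns the fixed-point equation into commutation.\<close>

lemma double_conj_eq_iff:
  assumes "a \<in> carrier G" "b \<in> carrier G" "c \<in> carrier G"
  shows "inv b \<otimes> (inv a \<otimes> c \<otimes> a) \<otimes> b = c \<longleftrightarrow> c \<otimes> (a \<otimes> b) = (a \<otimes> b) \<otimes> c"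
proof -
  have "inv b \<otimes> (inv a \<otimes> c \<otimes> a) \<otimes> b = inv (a \<otimes> b) \<otimes> (c \<otimes> (a \<otimes> b))"
    using assms by (simp add: inv_mult_group m_assoc)
  then show ?thesis
    using assms by (metis inv_solve_left m_closed)
qed

text \<open>The iterated bracket sends each basis vector to a basis vector, so a diagonal entry is 1
  at a fixed index and 0 elsewhere, and the trace counts fixed indices.\<close>

lemma killing_basis_eq_commuting_count:
  assumes "finite C" "C \<subseteq> carrier G" "a \<in> carrier G" "b \<in> carrier G"
  shows "braided_killing_basis (class_braided_lie G C) a b
    = of_nat (commuting_count G C (a \<otimes> b))"
proof -
  have "braided_killing_basis (class_braided_lie G C) a b =
      (\<Sum>c\<in>C. if c \<otimes> (a \<otimes> b) = (a \<otimes> b) \<otimes> c then 1 else 0)"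
    unfolding braided_killing_basis_def bracket_class_braided_lie lookup_bvec
    using assms by (intro sum.cong) (auto simp: class_braided_lie_def double_conj_eq_iff subset_iff)
  then show ?thesis
    using assms(1) by (simp add: commuting_count_def sum.If_cases Int_def)
qed

lemma conj_mult:
  assumes "g \<in> carrier G" "x \<in> carrier G" "y \<in> carrier G"
  shows "(g \<otimes> x \<otimes> inv g) \<otimes> (g \<otimes> y \<otimes> inv g) = g \<otimes> (x \<otimes> y) \<otimes> inv g"
  \<comment> \<open>After everything is associated to the right, associating back to the left puts
    \<open>inv g\<close> directly against \<open>g\<close>, where they cancel.\<close>
  using assms by (simp add: m_assoc) (simp flip: m_assoc)

lemma conj_inv_conj:
  assumes "g \<in> carrier G" "x \<in> carrier G"
  shows "g \<otimes> (inv g \<otimes> x \<otimes> g) \<otimes> inv g = x"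
  using assms by (simp add: m_assoc) (simp flip: m_assoc)

lemma conj_eq_conj_iff:
  assumes "g \<in> carrier G" "x \<in> carrier G" "y \<in> carrier G"
  shows "g \<otimes> x \<otimes> inv g = g \<otimes> y \<otimes> inv g \<longleftrightarrow> x = y"
  using assms by simp

text \<open>Conjugation by \<open>g\<close> is an automorphism that preserves \<open>C\<close>, so
  it carries the elements of \<open>C\<close> commuting with \<open>h\<close> bijectively onto those
  commuting with the conjugate of \<open>h\<close>.\<close>

lemma commuting_count_conj:
  assumes C: "conjugation_stable G C" and g: "g \<in> carrier G" and h: "h \<in> carrier G"
  shows "commuting_count G C (g \<otimes> h \<otimes> inv g) = commuting_count G C h"
proof -
  have CG: "C \<subseteq> carrier G" using C by (simp add: conjugation_stable_def)
  \<comment> \<open>The second membership is stability under \<open>inv g\<close>, whose inverse is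
    \<open>g\<close>.\<close>
  have stable: "g \<otimes> c \<otimes> inv g \<in> C" "inv g \<otimes> c \<otimes> g \<in> C" if "c \<in> C" for c
    using C g that inv_closed[OF g] by (auto simp: conjugation_stable_def dest: bspec[of _ _ "inv g"])
  have iff: "(g \<otimes> c \<otimes> inv g) \<otimes> (g \<otimes> h \<otimes> inv g) = (g \<otimes> h \<otimes> inv g) \<otimes> (g \<otimes> c \<otimes> inv g)
      \<longleftrightarrow> c \<otimes> h = h \<otimes> c" if "c \<in> C" for c
    using that CG g h by (simp add: conj_mult conj_eq_conj_iff subset_iff)
  have "bij_betw (\<lambda>c. g \<otimes> c \<otimes> inv g) {c \<in> C. c \<otimes> h = h \<otimes> c}
      {c \<in> C. c \<otimes> (g \<otimes> h \<otimes> inv g) = (g \<otimes> h \<otimes> inv g) \<otimes> c}"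
  proof (intro bij_betw_imageI)
    show "inj_on (\<lambda>c. g \<otimes> c \<otimes> inv g) {c \<in> C. c \<otimes> h = h \<otimes> c}"
      using CG g by (auto intro!: inj_onI simp: conj_eq_conj_iff subset_iff)
    show "(\<lambda>c. g \<otimes> c \<otimes> inv g) ` {c \<in> C. c \<otimes> h = h \<otimes> c} =
        {c \<in> C. c \<otimes> (g \<otimes> h \<otimes> inv g) = (g \<otimes> h \<otimes> inv g) \<otimes> c}" (is "?f ` ?A = ?B")
    proof
      show "?f ` ?A \<subseteq> ?B" using stable iff by blast
      show "?B \<subseteq> ?f ` ?A"
      proof
        fix d assume d: "d \<in> ?B"
        \<comment> \<open>The preimage of \<open>d\<close> is obtained by conjugating back;
          \<open>iff\<close> then transfers the commutation from \<open>d\<close> to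
          \<open>?c\<close>.\<close>
        let ?c = "inv g \<otimes> d \<otimes> g"
        have "?f ?c = d" using d CG g by (auto intro: conj_inv_conj)
        moreover have "?c \<in> C" using d stable by blast
        ultimately show "d \<in> ?f ` ?A"
          using d iff[of ?c] by (intro image_eqI[of _ _ ?c]) simp_all
      qed
    qed
  qed
  then show ?thesis
    unfolding commuting_count_def by (rule bij_betw_same_card[symmetric])
qed

lemma commuting_count_mult_commute:
  assumes "conjugation_stable G C" "a \<in> carrier G" "b \<in> carrier G"
  shows "commuting_count G C (a \<otimes> b) = commuting_count G C (b \<otimes> a)"
proof -
  have "b \<otimes> a = b \<otimes> (a \<otimes> b) \<otimes> inv b"
    using assms by (simp add: m_assoc)
  then show ?thesis
    using commuting_count_conj[of C b "a \<otimes> b"] assms by (metis m_closed)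
qed

end

theorem proposition5p4:
  fixes G :: "('a, 'm) monoid_scheme" (structure)
    and C :: "'a set"
    and L :: "'a braided_lie"
    and \<eta> :: "('a \<Rightarrow>\<^sub>0 complex) \<Rightarrow> ('a \<Rightarrow>\<^sub>0 complex) \<Rightarrow> complex"
  assumes "group G" and "finite (carrier G)"
    and "conjugation_stable G C" and "\<one> \<notin> C"
    and "L = class_braided_lie G C"
    and "\<eta> = braided_killing L"
  shows "bilinear_form_on (bl_space L) \<eta>
    \<and> symmetric_form_on (bl_space L) \<eta>
    \<and> (\<forall>a\<in>C. \<forall>b\<in>C. \<eta> (bvec a) (bvec b) \<in> \<nat>)
    \<and> (\<forall>g\<in>carrier G. \<forall>a\<in>C. \<forall>b\<in>C.
         \<eta> (bvec (g \<otimes> a \<otimes> inv g)) (bvec (g \<otimes> b \<otimes> inv g)) = \<eta> (bvec a) (bvec b))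
    \<and> (\<forall>a\<in>C. \<forall>b\<in>C.
         \<eta> (bvec a) (bvec b) = of_nat (commuting_count G C (a \<otimes> b))
       \<and> of_nat (commuting_count G C (a \<otimes> b)) = \<eta> (bvec b) (bvec (inv b \<otimes> a \<otimes> b)))
    \<and> (semisimple_class G C \<longleftrightarrow> nondegenerate_form_on (bl_space L) \<eta>)"
proof -
  interpret group G by fact
  have CG: "C \<subseteq> carrier G" using assms(3) by (simp add: conjugation_stable_def)
  then have fin: "finite C" using assms(2) by (rule finite_subset)
  have space: "bl_space L = free_space C"
    by (simp add: assms(5) bl_space_def class_braided_lie_def)
  \<comment> \<open>Stating this on the whole carrier lets it apply to conjugates of
    \<open>a\<close> and \<open>b\<close> by closure of the group operations alone.\<close>
  have basis: "braided_killing_basis L a b = of_nat (commuting_count G C (a \<otimes> b))"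
    if "a \<in> carrier G" "b \<in> carrier G" for a b
    using that fin CG by (simp add: assms(5) killing_basis_eq_commuting_count)
  have form: "\<eta> (bvec a) (bvec b) = of_nat (commuting_count G C (a \<otimes> b))"
    if "a \<in> carrier G" "b \<in> carrier G" for a b
    using that by (simp add: assms(6) braided_killing_bvec basis)
  have "bilinear_form_on (bl_space L) \<eta>"
    by (simp add: space assms(6) bilinear_braided_killing fin)
  moreover have "symmetric_form_on (bl_space L) \<eta>"
    unfolding space assms(6)
    using fin CG assms(3)
    by (intro symmetric_braided_killing) (auto simp: basis commuting_count_mult_commute subset_iff)
  moreover have "\<eta> (bvec (g \<otimes> a \<otimes> inv g)) (bvec (g \<otimes> b \<otimes> inv g)) = \<eta> (bvec a) (bvec b)"
    if "g \<in> carrier G" "a \<in> C" "b \<in> C" for g a b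
    using that CG assms(3) by (simp add: form conj_mult commuting_count_conj subset_iff)
  moreover have "of_nat (commuting_count G C (a \<otimes> b)) = \<eta> (bvec b) (bvec (inv b \<otimes> a \<otimes> b))"
    if "a \<in> C" "b \<in> C" for a b
  proof -
    have ab: "a \<in> carrier G" "b \<in> carrier G" using that CG by auto
    \<comment> \<open>The form depends only on the product of its two indices, and the pair
      \<open>b\<close>, \<open>inv b \<otimes> a \<otimes> b\<close> has the same product as
      \<open>a\<close>, \<open>b\<close>.\<close>
    then have "b \<otimes> (inv b \<otimes> a \<otimes> b) = a \<otimes> b"
      by (metis inv_solve_left m_assoc inv_closed m_closed)
    with ab show ?thesis by (simp add: form)
  qed
  moreover have "semisimple_class G C \<longleftrightarrow> nondegenerate_form_on (bl_space L) \<eta>"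
    by (simp add: semisimple_class_def assms(5,6))
  moreover have "\<eta> (bvec a) (bvec b) = of_nat (commuting_count G C (a \<otimes> b))"
    if "a \<in> C" "b \<in> C" for a b
    using that CG by (intro form) auto
  moreover from this have "\<eta> (bvec a) (bvec b) \<in> \<nat>" if "a \<in> C" "b \<in> C" for a b
    using that by simp
  ultimately show ?thesis
    by blast
qed

end
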